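(* Let $G=G(V,E)$ be a connected simple graph with $|V|=n$, and let $(O_t)_{t\ge0}$ be the Edge-Label-Reversal stochastic process on the acyclic orientations of $G$. Then for every acyclic orientation $O$ of $G$, $$\lim_{N\to\infty}\frac1N\sum_{t=1}^N\mathbb{P}(O_t=O)=\frac{e(O)}{n!},$$ independently of the initial choice of $O_0$ (equivalently of $f_0$).
   Context: The Edge-Label-Reversal process: choose an arbitrary bijection $f_0:V\to[n]$. For $t\ge1$, choose an edge $e_t=\{u_t,v_t\}\in E$ uniformly at random (independently) and let $f_t$ be $f_{t-1}$ with the values at $u_t$ and $v_t$ swapped. $O_t$ is the acyclic orientation of $G$ induced by $f_t$: each edge $\{u,v\}$ is oriented $(u,v)$ iff $f_t(u)<f_t(v)$. An acyclic orientation $O$ is viewed as the poset on $V$ it generates ($(u,v)$ meaning $u<_O v$), and $e(O)$ is its number of linear extensions, i.e. bijections $f:V\to[n]$ with $u<_O v\Rightarrow f(u)<f(v)$. *)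

theory Defs
  imports "HOL-Probability.Probability"
begin

definition simple_graph :: "'a set \<Rightarrow> 'a set set \<Rightarrow> bool" where
  "simple_graph V E \<longleftrightarrow> finite V \<and> (\<forall>e\<in>E. e \<subseteq> V \<and> card e = 2)"

definition connected_graph :: "'a set \<Rightarrow> 'a set set \<Rightarrow> bool" where
  "connected_graph V E \<longleftrightarrow> V \<noteq> {} \<and> (\<forall>u\<in>V. \<forall>v\<in>V. (u, v) \<in> {(x, y). {x, y} \<in> E}\<^sup>*)"

text \<open>An orientation is given by its set of arcs, \<open>(u, v)\<close> being the edge directed from \<open>u\<close> to \<open>v\<close>.\<close>

definition orientation :: "'a set set \<Rightarrow> ('a \<times> 'a) set \<Rightarrow> bool" where
  "orientation E D \<longleftrightarrow>
     (\<forall>(u, v)\<in>D. {u, v} \<in> E) \<and>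
     (\<forall>u v. {u, v} \<in> E \<longrightarrow> ((u, v) \<in> D \<longleftrightarrow> (v, u) \<notin> D))"

definition acyclic_orientation :: "'a set set \<Rightarrow> ('a \<times> 'a) set \<Rightarrow> bool" where
  "acyclic_orientation E D \<longleftrightarrow> orientation E D \<and> acyclic D"

definition induced_orientation :: "'a set set \<Rightarrow> ('a \<Rightarrow> nat) \<Rightarrow> ('a \<times> 'a) set" where
  "induced_orientation E f = {(u, v). {u, v} \<in> E \<and> f u < f v}"

text \<open>The strict order generated by \<open>D\<close> is its transitive closure. Labellings are taken
  extensional, so that each bijection of \<open>V\<close> onto \<open>{1..card V}\<close> is counted once.\<close>

definition linear_extensions :: "'a set \<Rightarrow> ('a \<times> 'a) set \<Rightarrow> ('a \<Rightarrow> nat) set" where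
  "linear_extensions V D =
     {f \<in> extensional V. bij_betw f V {1..card V} \<and> (\<forall>(u, v)\<in>D\<^sup>+. f u < f v)}"

definition swap_labels :: "'a set \<Rightarrow> ('a \<Rightarrow> nat) \<Rightarrow> 'a \<Rightarrow> nat" where
  "swap_labels e f = (\<lambda>x. if x \<in> e then f (the_elem (e - {x})) else f x)"

lemma swap_labels_doubleton:
  assumes "u \<noteq> v"
  shows "swap_labels {u, v} f = f(u := f v, v := f u)"
proof -
  have "{u, v} - {u} = {v}" "{u, v} - {v} = {u}"
    using assms by auto
  then show ?thesis
    using assms by (auto simp: swap_labels_def fun_eq_iff)
qed

text \<open>\<open>e t \<omega>\<close> is the edge chosen at time \<open>t \<ge> 1\<close>; the value \<open>e 0 \<omega>\<close> is never used.\<close>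

primrec labelling :: "('a \<Rightarrow> nat) \<Rightarrow> (nat \<Rightarrow> 'w \<Rightarrow> 'a set) \<Rightarrow> nat \<Rightarrow> 'w \<Rightarrow> 'a \<Rightarrow> nat" where
  "labelling f0 e 0 \<omega> = f0"
| "labelling f0 e (Suc t) \<omega> = swap_labels (e (Suc t) \<omega>) (labelling f0 e t \<omega>)"

definition edge_label_reversal ::
    "'a set set \<Rightarrow> ('a \<Rightarrow> nat) \<Rightarrow> (nat \<Rightarrow> 'w \<Rightarrow> 'a set) \<Rightarrow> nat \<Rightarrow> 'w \<Rightarrow> ('a \<times> 'a) set" where
  "edge_label_reversal E f0 e t \<omega> = induced_orientation E (labelling f0 e t \<omega>)"

text \<open>For \<open>E = {}\<close> no probability space \<open>M\<close> satisfies this, as \<open>uniform_count_measure {}\<close> is not a probability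
  measure: there is then no edge to choose.\<close>

definition iid_uniform_edges :: "'w measure \<Rightarrow> 'a set set \<Rightarrow> (nat \<Rightarrow> 'w \<Rightarrow> 'a set) \<Rightarrow> bool" where
  "iid_uniform_edges M E e \<longleftrightarrow>
     prob_space.indep_vars M (\<lambda>_. count_space E) e {1..} \<and>
     (\<forall>t\<ge>1. distr M (count_space E) (e t) = uniform_count_measure E)"

end

theory Submission
  imports Defs "HOL-Combinatorics.Permutations"
begin

text \<open>
  Let \<open>p\<^sub>t(f)\<close> be the probability that the labelling at time \<open>t\<close> is \<open>f\<close>. As swapping along an edge is an
  involution, \<open>p\<^sub>t\<close> evolves by the symmetric operator \<open>T\<close> that averages over the edge swaps. The
  Cesaro means \<open>a\<^sub>N\<close> satisfy \<open>a\<^sub>N - T a\<^sub>N = O(1/N)\<close>, so their Dirichlet form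
  \<open>\<Sum>\<^sub>f \<Sum>\<^sub>e (a\<^sub>N(f) - a\<^sub>N(e f))\<^sup>2\<close> tends to \<open>0\<close>, and \<open>a\<^sub>N(f) - a\<^sub>N(g) \<rightarrow> 0\<close> whenever \<open>f\<close> and \<open>g\<close> are
  connected by edge swaps. The edges of a connected graph, viewed as transpositions, generate the
  full symmetric group, so \<open>a\<^sub>N\<close> becomes uniform on the \<open>n!\<close> labellings; those inducing \<open>D\<close> are exactly
  the linear extensions of \<open>D\<close>.
\<close>

section \<open>Cesaro means\<close>

text \<open>Termwise, the square minus twice the product is
  \<open>(a (s i x))\<^sup>2 - (a x)\<^sup>2\<close>. Summed over \<open>X\<close> this vanishes,
  since each \<open>s i\<close> only rearranges \<open>X\<close>.\<close>

lemma dirichlet_form_bijections: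
  fixes a :: "'s \<Rightarrow> real"
  assumes "\<And>i. i \<in> A \<Longrightarrow> bij_betw (s i) X X"
  shows "(\<Sum>x\<in>X. \<Sum>i\<in>A. (a x - a (s i x))\<^sup>2) = 2 * (\<Sum>x\<in>X. \<Sum>i\<in>A. a x * (a x - a (s i x)))"
proof -
  have inv: "(\<Sum>x\<in>X. (a (s i x))\<^sup>2) = (\<Sum>x\<in>X. (a x)\<^sup>2)" if "i \<in> A" for i
    using sum.reindex_bij_betw[OF assms[OF that], of "\<lambda>x. (a x)\<^sup>2"] .
  have "(\<Sum>x\<in>X. \<Sum>i\<in>A. (a x - a (s i x))\<^sup>2) - 2 * (\<Sum>x\<in>X. \<Sum>i\<in>A. a x * (a x - a (s i x)))
      = (\<Sum>x\<in>X. \<Sum>i\<in>A. (a (s i x))\<^sup>2 - (a x)\<^sup>2)"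
    unfolding sum_distrib_left sum_subtractf[symmetric]
    by (intro sum.cong refl) (simp add: power2_eq_square algebra_simps)
  also have "\<dots> = (\<Sum>i\<in>A. (\<Sum>x\<in>X. (a (s i x))\<^sup>2) - (\<Sum>x\<in>X. (a x)\<^sup>2))"
    by (subst sum.swap) (simp add: sum_subtractf)
  also have "\<dots> = 0"
    by (simp add: inv)
  finally show ?thesis by simp
qed

text \<open>The defect of the mean telescopes to size O(1/N). Pairing it with the mean itself, which
  is bounded by 1, gives half of the Dirichlet form by the identity above. Every single squared
  difference is a summand of that form, hence also O(1/N).\<close>

lemma cesaro_mean_difference_tendsto_0:
  fixes p :: "nat \<Rightarrow> 's \<Rightarrow> real"
  assumes fin: "finite X" "finite A" "A \<noteq> {}"
    and bij: "\<And>i. i \<in> A \<Longrightarrow> bij_betw (s i) X X"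
    and bounds: "\<And>t x. 0 \<le> p t x" "\<And>t x. p t x \<le> 1"
    and step: "\<And>t x. x \<in> X \<Longrightarrow> p (Suc t) x = (\<Sum>i\<in>A. p t (s i x)) / card A"
    and y: "y \<in> X" and j: "j \<in> A"
  shows "(\<lambda>N. (\<Sum>t=1..N. p t y) / N - (\<Sum>t=1..N. p t (s j y)) / N) \<longlonglongrightarrow> 0"
proof -
  define a where "a N x = (\<Sum>t=1..N. p t x) / real N" for N x
  define C where "C = 2 * real (card X) * real (card A)"
  have m: "real (card A) > 0"
    using fin by (simp add: card_gt_0_iff)
  have a01: "0 \<le> a N x" "a N x \<le> 1" for N x
  proof -
    show "0 \<le> a N x"
      unfolding a_def by (intro divide_nonneg_nonneg sum_nonneg bounds) auto
    have "(\<Sum>t=1..N. p t x) \<le> real N"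
      using sum_bounded_above[of "{1..N}" "\<lambda>t. p t x" 1] bounds(2) by simp
    then show "a N x \<le> 1"
      unfolding a_def by (cases "N = 0") auto
  qed
  \<comment> \<open>By \<open>step\<close>, averaging over \<open>A\<close> shifts time by one, so
    only the two boundary terms survive. For \<open>N = 0\<close> both sides are 0, as division by
    zero yields 0.\<close>
  have defect: "(\<Sum>i\<in>A. a N x - a N (s i x)) = card A * (p 1 x - p (Suc N) x) / N"
    if "x \<in> X" for N x
  proof -
    have "(\<Sum>i\<in>A. a N (s i x)) = (\<Sum>t=1..N. \<Sum>i\<in>A. p t (s i x)) / N"
      unfolding a_def sum_divide_distrib[symmetric] by (subst sum.swap) simp
    also have "\<dots> = (\<Sum>t=1..N. card A * p (Suc t) x) / N"
      using step[OF that] m by simp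
    finally have "(\<Sum>i\<in>A. a N x - a N (s i x))
        = card A * ((\<Sum>t=1..N. p t x) - (\<Sum>t=1..N. p (Suc t) x)) / N"
      by (simp add: sum_subtractf a_def sum_distrib_left diff_divide_distrib right_diff_distrib)
    also have "(\<Sum>t=1..N. p t x) - (\<Sum>t=1..N. p (Suc t) x) = p 1 x - p (Suc N) x"
      by (induction N) auto
    finally show ?thesis .
  qed
  have bound: "(a N y - a N (s j y))\<^sup>2 \<le> C / N" for N
  proof -
    have "(a N y - a N (s j y))\<^sup>2 \<le> (\<Sum>i\<in>A. (a N y - a N (s i y))\<^sup>2)"
      using member_le_sum[OF j, of "\<lambda>i. (a N y - a N (s i y))\<^sup>2"] fin by simp
    also have "\<dots> \<le> (\<Sum>x\<in>X. \<Sum>i\<in>A. (a N x - a N (s i x))\<^sup>2)"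
      using member_le_sum[OF y, of "\<lambda>x. \<Sum>i\<in>A. (a N x - a N (s i x))\<^sup>2"] fin
      by (simp add: sum_nonneg)
    also have "\<dots> = 2 * (\<Sum>x\<in>X. a N x * (card A * (p 1 x - p (Suc N) x) / N))"
      by (subst dirichlet_form_bijections[OF bij]) (simp_all add: sum_distrib_left[symmetric] defect)
    \<comment> \<open>The difference \<open>p 1 x - p (Suc N) x\<close> may be negative. It is
      therefore bounded by 1 first, under the nonnegative factor \<open>a N x\<close>, and only then
      is \<open>a N x\<close> replaced by 1.\<close>
    also have "\<dots> \<le> 2 * (\<Sum>x\<in>X. 1 * (real (card A) * 1 / N))"
    proof (intro mult_left_mono sum_mono)
      fix x
      have "p 1 x - p (Suc N) x \<le> 1"
        using bounds(1)[of "Suc N" x] bounds(2)[of 1 x] by linarith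
      then have "card A * (p 1 x - p (Suc N) x) / N \<le> real (card A) * 1 / N"
        by (intro divide_right_mono mult_left_mono) auto
      then have "a N x * (card A * (p 1 x - p (Suc N) x) / N) \<le> a N x * (real (card A) * 1 / N)"
        using a01(1) by (rule mult_left_mono)
      also have "\<dots> \<le> 1 * (real (card A) * 1 / N)"
        using a01(2) by (rule mult_right_mono) simp
      finally show "a N x * (card A * (p 1 x - p (Suc N) x) / N) \<le> 1 * (real (card A) * 1 / N)" .
    qed simp
    also have "\<dots> = C / N"
      by (simp add: C_def)
    finally show ?thesis .
  qed
  have "(\<lambda>N. (a N y - a N (s j y))\<^sup>2) \<longlonglongrightarrow> 0"
    by (rule tendsto_sandwich[OF _ _ tendsto_const lim_const_over_n[of C]]) (auto simp: bound)
  then have "(\<lambda>N. a N y - a N (s j y)) \<longlonglongrightarrow> 0"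
    by (auto dest: tendsto_real_sqrt simp: tendsto_rabs_zero_iff)
  then show ?thesis
    by (simp add: a_def)
qed

section \<open>Labellings and edge swaps\<close>

text \<open>Conjugation extends edge transpositions along walks: (u w) = (u v)(v w)(u v).
  Connectedness thus yields all transpositions, and these generate the symmetric group. The
  predicate \<open>P\<close> is abstract so that it can later be a convergence property closed under
  composition.\<close>

lemma edge_transpositions_generate:
  assumes "connected_graph V E" "finite V"
    and id: "P id" and comp: "\<And>p q. P p \<Longrightarrow> P q \<Longrightarrow> P (p \<circ> q)"
    and edge: "\<And>u v. {u, v} \<in> E \<Longrightarrow> P (Transposition.transpose u v)"
    and "p permutes V"
  shows "P p"
proof -
  have transp: "P (Transposition.transpose u v)" if "(u, v) \<in> {(x, y). {x, y} \<in> E}\<^sup>*" for u v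
    using that
  proof (induction rule: rtrancl_induct)
    case base
    then show ?case using id by (simp add: id_def)
  next
    case (step v w)
    then have vw: "P (Transposition.transpose v w)"
      using edge by simp
    show ?case
    \<comment> \<open>The conjugation identity needs distinct vertices. If two coincide, the goal is
      the edge transposition, the identity or the induction hypothesis.\<close>
    proof (cases "u = v \<or> u = w \<or> v = w")
      case True
      then show ?thesis using vw step.IH id by (auto simp: id_def)
    next
      case False
      then have "Transposition.transpose u w
          = Transposition.transpose u v \<circ> (Transposition.transpose v w \<circ> Transposition.transpose u v)"
        by (auto simp: fun_eq_iff Transposition.transpose_def)
      then show ?thesis using comp vw step.IH by metis
    qed
  qed
  show ?thesis
    using \<open>p permutes V\<close> \<open>finite V\<close>
  proof (induction rule: permutes_induct)
    case (swap a b p)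
    then have "P (Transposition.transpose a b)"
      using transp \<open>connected_graph V E\<close> by (simp add: connected_graph_def)
    then show ?case
      using comp \<open>P p\<close> by blast
  qed (rule id)
qed

section \<open>The symmetric group acting on labellings\<close>

definition labellings :: "'a set \<Rightarrow> ('a \<Rightarrow> nat) set" where
  "labellings V = {f \<in> extensional V. bij_betw f V {1..card V}}"

lemma labellings_comp_permutes:
  assumes "f \<in> labellings V" "p permutes V"
  shows "f \<circ> p \<in> labellings V"
proof -
  have "bij_betw (f \<circ> p) V {1..card V}"
    using assms bij_betw_trans[OF permutes_imp_bij] unfolding labellings_def by blast
  then show ?thesis
    using assms by (auto simp: labellings_def extensional_def permutes_not_in)
qed

text \<open>The action by precomposition is transitive: the inverse of \<open>f\<close> on
  \<open>V\<close>, composed with \<open>g\<close>, carries \<open>f\<close> to \<open>g\<close>. It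
  is extended by the identity off \<open>V\<close>, as \<open>permutes\<close> requires; there
  \<open>f\<close> and \<open>g\<close> agree by extensionality.\<close>

lemma labellings_eq_image:
  assumes "f \<in> labellings V"
  shows "labellings V = (\<lambda>p. f \<circ> p) ` {p. p permutes V}"
proof (intro equalityI subsetI)
  fix g assume g: "g \<in> labellings V"
  define p where "p x = (if x \<in> V then inv_into V f (g x) else x)" for x
  have f: "bij_betw f V {1..card V}"
    using assms by (simp add: labellings_def)
  have "bij_betw (inv_into V f \<circ> g) V V"
    using g bij_betw_inv_into[OF f] bij_betw_trans unfolding labellings_def by blast
  then have "bij_betw p V V"
    by (rule bij_betw_cong[THEN iffD1, rotated]) (simp add: p_def)
  then have "p permutes V"
    by (rule bij_imp_permutes) (simp add: p_def)
  moreover have "g = f \<circ> p"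
  proof
    fix x
    have "g x \<in> f ` V" if "x \<in> V"
      using that g f by (auto simp: labellings_def bij_betw_def)
    then show "g x = (f \<circ> p) x"
      using g assms by (auto simp: p_def labellings_def extensional_def f_inv_into_f)
  qed
  ultimately show "g \<in> (\<lambda>p. f \<circ> p) ` {p. p permutes V}"
    by blast
qed (use assms in \<open>auto intro: labellings_comp_permutes\<close>)

text \<open>The action is also free, because \<open>f\<close> is injective on \<open>V\<close>; so
  there are as many labellings as permutations of \<open>V\<close>.\<close>

lemma card_labellings:
  assumes "f \<in> labellings V" "finite V"
  shows "finite (labellings V)" "card (labellings V) = fact (card V)"
proof -
  have "inj_on (\<lambda>p. f \<circ> p) {p. p permutes V}"
  proof (rule inj_onI, rule ext)
    fix p q x assume pq: "p \<in> {p. p permutes V}" "q \<in> {p. p permutes V}" "f \<circ> p = f \<circ> q"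
    then have "f (p x) = f (q x)"
      by (metis comp_apply)
    moreover have "inj_on f V"
      using assms by (auto simp: labellings_def bij_betw_def)
    ultimately show "p x = q x"
      using pq by (cases "x \<in> V") (auto simp: permutes_in_image permutes_not_in dest: inj_onD)
  qed
  then show "card (labellings V) = fact (card V)"
    unfolding labellings_eq_image[OF assms(1)] by (simp add: card_image card_permutations \<open>finite V\<close>)
  show "finite (labellings V)"
    unfolding labellings_eq_image[OF assms(1)] by (simp add: finite_permutations \<open>finite V\<close>)
qed

lemma swap_labels_eq_comp_transpose:
  assumes "u \<noteq> v"
  shows "swap_labels {u, v} f = f \<circ> Transposition.transpose u v"
  using assms by (auto simp: swap_labels_doubleton fun_eq_iff Transposition.transpose_def)

lemma swap_labels_involutory:
  assumes "card x = 2"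
  shows "swap_labels x (swap_labels x f) = f"
  using assms by (auto simp: card_2_iff swap_labels_eq_comp_transpose comp_assoc)

lemma swap_labels_in_labellings:
  assumes "card x = 2" "x \<subseteq> V" "f \<in> labellings V"
  shows "swap_labels x f \<in> labellings V"
  using assms
  by (auto simp: card_2_iff swap_labels_eq_comp_transpose
      intro!: labellings_comp_permutes permutes_swap_id)

lemma bij_betw_swap_labels:
  assumes "card x = 2" "x \<subseteq> V"
  shows "bij_betw (swap_labels x) (labellings V) (labellings V)"
  by (rule bij_betw_byWitness[where f' = "swap_labels x"])
    (use assms in \<open>auto simp: swap_labels_involutory swap_labels_in_labellings\<close>)

lemma swap_labels_restrict:
  assumes "card x = 2" "x \<subseteq> V"
  shows "swap_labels x (restrict f V) = restrict (swap_labels x f) V"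
  using assms by (auto simp: card_2_iff swap_labels_doubleton fun_eq_iff)

text \<open>An initial labelling may take arbitrary values off \<open>V\<close>. Swaps along edges
  inside \<open>V\<close> commute with restriction, which reduces the process to extensional
  labellings.\<close>

lemma labelling_restrict:
  assumes "\<And>t. t \<ge> 1 \<Longrightarrow> card (e t \<omega>) = 2 \<and> e t \<omega> \<subseteq> V"
  shows "labelling (restrict f V) e t \<omega> = restrict (labelling f e t \<omega>) V"
  using assms by (induction t) (simp_all add: swap_labels_restrict)

lemma labelling_in_labellings:
  assumes "f \<in> labellings V" "\<And>t. t \<ge> 1 \<Longrightarrow> card (e t \<omega>) = 2 \<and> e t \<omega> \<subseteq> V"
  shows "labelling f e t \<omega> \<in> labellings V"
  using assms by (induction t) (simp_all add: swap_labels_in_labellings)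

lemma labelling_cong:
  assumes "\<And>k. 1 \<le> k \<Longrightarrow> k \<le> t \<Longrightarrow> e k \<omega> = e' k \<omega>'"
  shows "labelling f e t \<omega> = labelling f e' t \<omega>'"
  using assms by (induction t) simp_all

lemma induced_orientation_restrict:
  assumes "simple_graph V E"
  shows "induced_orientation E (restrict f V) = induced_orientation E f"
  using assms by (fastforce simp: induced_orientation_def simple_graph_def)

text \<open>If \<open>f\<close> increases along \<open>D\<close>, an edge with
  \<open>f u < f v\<close> cannot be directed from \<open>v\<close> to \<open>u\<close>, so the
  orientation directs it from \<open>u\<close> to \<open>v\<close>. Conversely, increase along arcs
  propagates to the transitive closure.\<close>

lemma linear_extensions_eq:
  assumes "simple_graph V E" "orientation E D"
  shows "linear_extensions V D = {f \<in> labellings V. induced_orientation E f = D}"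
proof -
  have "(\<forall>(u, v)\<in>D\<^sup>+. f u < f v) \<longleftrightarrow> induced_orientation E f = D" if f: "f \<in> labellings V" for f
  proof
    assume lt: "\<forall>(u, v)\<in>D\<^sup>+. f u < f v"
    have "(u, v) \<in> induced_orientation E f \<longleftrightarrow> (u, v) \<in> D" for u v
    proof
      assume "(u, v) \<in> D"
      then show "(u, v) \<in> induced_orientation E f"
        using lt assms(2) by (auto simp: induced_orientation_def orientation_def)
    next
      assume uv: "(u, v) \<in> induced_orientation E f"
      then have "(v, u) \<notin> D\<^sup>+"
        using lt by (auto simp: induced_orientation_def)
      then show "(u, v) \<in> D"
        using uv assms(2) by (auto simp: induced_orientation_def orientation_def)
    qed
    then show "induced_orientation E f = D"
      by auto
  next
    assume D: "induced_orientation E f = D"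
    have "f u < f v" if "(u, v) \<in> D\<^sup>+" for u v
      using that by (induction rule: trancl_induct) (auto simp: D[symmetric] induced_orientation_def)
    then show "\<forall>(u, v)\<in>D\<^sup>+. f u < f v"
      by auto
  qed
  then show ?thesis
    by (auto simp: linear_extensions_def labellings_def)
qed

section \<open>The law of the labelling process\<close>

context prob_space
begin

lemma edge_measurable:
  assumes "iid_uniform_edges M E e" "t \<ge> 1"
  shows "e t \<in> measurable M (count_space E)"
  using assms by (simp add: iid_uniform_edges_def indep_vars_def)

text \<open>The labelling at time \<open>t\<close> is a fixed function of the edges at times 1 to
  \<open>t\<close>. This gives both its measurability and its independence from the next
  edge.\<close>

lemma labelling_eq_comp_restrict:
  "labelling f e t = labelling f (\<lambda>i w. w i) t \<circ> (\<lambda>\<omega>. restrict (\<lambda>i. e i \<omega>) {1..t})"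
  by (rule ext, unfold comp_apply, rule labelling_cong) simp

lemma labelling_measurable:
  assumes iid: "iid_uniform_edges M E e" and "finite E"
  shows "labelling f e t \<in> measurable M (count_space UNIV)"
proof -
  have "(\<lambda>\<omega>. restrict (\<lambda>i. e i \<omega>) {1..t}) \<in> measurable M (PiM {1..t} (\<lambda>_. count_space E))"
    using edge_measurable[OF iid] by (intro measurable_restrict) auto
  \<comment> \<open>A finite product of finite discrete spaces is discrete, so every function on it
    is measurable.\<close>
  then show ?thesis
    by (subst labelling_eq_comp_restrict, rule measurable_comp)
      (simp add: count_space_PiM_finite \<open>finite E\<close> countable_finite)
qed

text \<open>\<open>indep_var\<close> forces both variables to have the same value type, hence the detour through
  Boolean-valued indicators.\<close>

lemma prob_labelling_and_next_edge:
  assumes iid: "iid_uniform_edges M E e" and "finite E"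
  shows "prob {\<omega> \<in> space M. labelling f e t \<omega> = h \<and> e (Suc t) \<omega> = x}
    = prob {\<omega> \<in> space M. labelling f e t \<omega> = h} * prob {\<omega> \<in> space M. e (Suc t) \<omega> = x}"
proof -
  let ?R = "\<lambda>I \<omega>. restrict (\<lambda>i. e i \<omega>) I"
  let ?A = "(\<lambda>w. labelling f (\<lambda>i w. w i) t w = h) \<circ> ?R {1..t}"
  let ?B = "(\<lambda>w. w (Suc t) = x) \<circ> ?R {Suc t}"
  have "indep_vars (\<lambda>_. count_space E) e {1..}"
    using iid by (simp add: iid_uniform_edges_def)
  then have "indep_var (PiM {1..t} (\<lambda>_. count_space E)) (?R {1..t})
      (PiM {Suc t} (\<lambda>_. count_space E)) (?R {Suc t})"
    by (rule indep_var_restrict) auto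
  then have "indep_var (count_space UNIV) ?A (count_space UNIV) ?B"
    by (rule indep_var_compose) (simp_all add: count_space_PiM_finite \<open>finite E\<close> countable_finite)
  from indep_varD[OF this, of "{True}" "{True}"]
  have "prob {\<omega> \<in> space M. ?A \<omega> \<and> ?B \<omega>} = prob {\<omega> \<in> space M. ?A \<omega>} * prob {\<omega> \<in> space M. ?B \<omega>}"
    by (simp add: vimage_def Int_def conj_commute)
  moreover have "?A = (\<lambda>\<omega>. labelling f e t \<omega> = h)"
    by (subst labelling_eq_comp_restrict) (simp add: fun_eq_iff)
  moreover have "?B = (\<lambda>\<omega>. e (Suc t) \<omega> = x)"
    by auto
  ultimately show ?thesis
    by metis
qed

lemma prob_edge:
  assumes iid: "iid_uniform_edges M E e" and "finite E" "t \<ge> 1" "x \<in> E"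
  shows "prob {\<omega> \<in> space M. e t \<omega> = x} = 1 / card E"
proof -
  have "{\<omega> \<in> space M. e t \<omega> = x} = e t -` {x} \<inter> space M"
    by auto
  also have "prob \<dots> = measure (distr M (count_space E) (e t)) {x}"
    using assms edge_measurable[OF iid] by (intro measure_distr[symmetric]) auto
  also have "\<dots> = 1 / card E"
    using assms by (simp add: iid_uniform_edges_def measure_uniform_count_measure)
  finally show ?thesis .
qed

lemma edges_nonempty:
  assumes iid: "iid_uniform_edges M E e"
  shows "E \<noteq> {}"
  using measurable_space[OF edge_measurable[OF iid, of 1]] not_empty by fastforce

text \<open>Split by the last edge \<open>x\<close>. As swapping is an involution, arriving at
  \<open>g\<close> through \<open>x\<close> means having been at \<open>swap_labels x g\<close>;
  independence and uniformity then give the factor \<open>1 / card E\<close>.\<close>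

lemma prob_labelling_Suc:
  assumes iid: "iid_uniform_edges M E e" and "finite E" and card2: "\<And>x. x \<in> E \<Longrightarrow> card x = 2"
  shows "prob {\<omega> \<in> space M. labelling f e (Suc t) \<omega> = g}
    = (\<Sum>x\<in>E. prob {\<omega> \<in> space M. labelling f e t \<omega> = swap_labels x g}) / card E"
proof -
  define B where "B x = {\<omega> \<in> space M. labelling f e t \<omega> = swap_labels x g \<and> e (Suc t) \<omega> = x}" for x
  have inE: "e (Suc t) \<omega> \<in> E" if "\<omega> \<in> space M" for \<omega>
    using measurable_space[OF edge_measurable[OF iid] that] by simp
  have B: "B x \<in> events" if "x \<in> E" for x
  proof -
    have "B x = (labelling f e t -` {swap_labels x g} \<inter> space M) \<inter> (e (Suc t) -` {x} \<inter> space M)"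
      by (auto simp: B_def)
    then show ?thesis
      using that measurable_sets[OF labelling_measurable[OF iid \<open>finite E\<close>]]
        measurable_sets[OF edge_measurable[OF iid]] by auto
  qed
  have "{\<omega> \<in> space M. labelling f e (Suc t) \<omega> = g} = (\<Union>x\<in>E. B x)"
    using inE by (auto simp: B_def swap_labels_involutory card2)
  also have "prob \<dots> = (\<Sum>x\<in>E. prob (B x))"
    using B \<open>finite E\<close> by (intro finite_measure_finite_Union) (auto simp: disjoint_family_on_def B_def)
  also have "\<dots> = (\<Sum>x\<in>E. prob {\<omega> \<in> space M. labelling f e t \<omega> = swap_labels x g} * (1 / card E))"
    unfolding B_def prob_labelling_and_next_edge[OF iid \<open>finite E\<close>]
    by (intro sum.cong refl) (simp add: prob_edge[OF iid \<open>finite E\<close>])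
  finally show ?thesis
    by (simp add: sum_divide_distrib)
qed

text \<open>Each swap changes the parity of the labelling, so the law at time \<open>t\<close>
  itself does not converge; its time averages do. Their pairwise differences vanish in the limit and
  their total is 1.\<close>

lemma cesaro_labelling_tendsto_uniform:
  assumes G: "simple_graph V E" "connected_graph V E" and iid: "iid_uniform_edges M E e"
    and f: "f \<in> labellings V" and g: "g \<in> labellings V"
  shows "(\<lambda>N. (\<Sum>t=1..N. prob {\<omega> \<in> space M. labelling f e t \<omega> = g}) / N) \<longlonglongrightarrow> 1 / fact (card V)"
proof -
  define p where "p t h = prob {\<omega> \<in> space M. labelling f e t \<omega> = h}" for t h
  define a where "a N h = (\<Sum>t=1..N. p t h) / real N" for N h
  have "finite V" and edges: "\<And>x. x \<in> E \<Longrightarrow> card x = 2 \<and> x \<subseteq> V"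
    using G by (auto simp: simple_graph_def)
  then have "finite E"
    by (auto intro: finite_subset[of E "Pow V"])
  note S = card_labellings[OF f \<open>finite V\<close>]
  have edge: "(\<lambda>N. a N h - a N (swap_labels x h)) \<longlonglongrightarrow> 0" if "x \<in> E" "h \<in> labellings V" for x h
    unfolding a_def
  proof (rule cesaro_mean_difference_tendsto_0[where X = "labellings V" and A = E])
    show "p (Suc t) h = (\<Sum>x\<in>E. p t (swap_labels x h)) / card E" for t h
      unfolding p_def using edges by (intro prob_labelling_Suc[OF iid \<open>finite E\<close>]) auto
  qed (use that S edges \<open>finite E\<close> edges_nonempty[OF iid] in \<open>auto simp: p_def bij_betw_swap_labels\<close>)
  have all: "(\<lambda>N. a N h - a N k) \<longlonglongrightarrow> 0" if h: "h \<in> labellings V" and k: "k \<in> labellings V" for h k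
  proof -
    \<comment> \<open>Quantifying over all \<open>h\<close> makes \<open>Q\<close> closed under
      composition: the difference for \<open>q \<circ> r\<close> at \<open>h\<close> is the one for
      \<open>q\<close> at \<open>h\<close> plus the one for \<open>r\<close> at
      \<open>h \<circ> q\<close>.\<close>
    define Q where "Q q \<longleftrightarrow> q permutes V \<and> (\<forall>h\<in>labellings V. (\<lambda>N. a N h - a N (h \<circ> q)) \<longlonglongrightarrow> 0)" for q
    obtain q where q: "q permutes V" "k = h \<circ> q"
      using k labellings_eq_image[OF h] by auto
    have "Q q"
    proof (rule edge_transpositions_generate[OF G(2) \<open>finite V\<close> _ _ _ q(1)])
      show "Q id"
        by (simp add: Q_def permutes_id)
      show "Q (q \<circ> r)" if "Q q" "Q r" for q r
        unfolding Q_def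
      proof (intro conjI ballI)
        show "q \<circ> r permutes V"
          using that by (auto simp: Q_def intro: permutes_compose)
        fix h assume h: "h \<in> labellings V"
        have "h \<circ> q \<in> labellings V"
          using that h labellings_comp_permutes by (auto simp: Q_def)
        then have "(\<lambda>N. (a N h - a N (h \<circ> q)) + (a N (h \<circ> q) - a N (h \<circ> q \<circ> r))) \<longlonglongrightarrow> 0 + 0"
          using that h by (intro tendsto_add) (auto simp: Q_def)
        then show "(\<lambda>N. a N h - a N (h \<circ> (q \<circ> r))) \<longlonglongrightarrow> 0"
          by (simp add: comp_assoc)
      qed
      show "Q (Transposition.transpose u v)" if "{u, v} \<in> E" for u v
      proof -
        have "u \<noteq> v" "u \<in> V" "v \<in> V"
          using edges[OF that] by (auto simp: card_2_iff doubleton_eq_iff)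
        then show ?thesis
          using edge[OF that] by (simp add: Q_def permutes_swap_id swap_labels_eq_comp_transpose)
      qed
    qed
    then show ?thesis
      using h q by (simp add: Q_def)
  qed
  have total: "(\<Sum>h\<in>labellings V. p t h) = 1" for t
  proof -
    have inS: "labelling f e t \<omega> \<in> labellings V" if "\<omega> \<in> space M" for \<omega>
      using measurable_space[OF edge_measurable[OF iid] that] edges
      by (intro labelling_in_labellings[OF f]) auto
    have "(\<Sum>h\<in>labellings V. p t h) = prob (\<Union>h\<in>labellings V. {\<omega> \<in> space M. labelling f e t \<omega> = h})"
      unfolding p_def using S labelling_measurable[OF iid \<open>finite E\<close>]
      by (intro finite_measure_finite_Union[symmetric]) (auto simp: disjoint_family_on_def)
    also have "(\<Union>h\<in>labellings V. {\<omega> \<in> space M. labelling f e t \<omega> = h}) = space M"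
      using inS by auto
    finally show ?thesis
      by (simp add: prob_space)
  qed
  \<comment> \<open>Since the means sum to 1 over the n! labellings, this expression equals
    \<open>a N g\<close>. That holds only from \<open>N = 1\<close> on: the empty mean is 0.\<close>
  have "(\<lambda>N. (1 + (\<Sum>h\<in>labellings V. a N g - a N h)) / fact (card V)) \<longlonglongrightarrow> (1 + (\<Sum>h\<in>labellings V. 0)) / fact (card V)"
    using all g by (intro tendsto_intros) auto
  moreover have "\<forall>\<^sub>F N in sequentially. (1 + (\<Sum>h\<in>labellings V. a N g - a N h)) / fact (card V) = a N g"
  proof (rule eventually_sequentiallyI[of 1])
    fix N :: nat assume "1 \<le> N"
    have "(\<Sum>h\<in>labellings V. a N h) = (\<Sum>t=1..N. \<Sum>h\<in>labellings V. p t h) / N"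
      unfolding a_def sum_divide_distrib[symmetric] by (subst sum.swap) simp
    also have "\<dots> = 1"
      using \<open>1 \<le> N\<close> by (simp add: total)
    finally show "(1 + (\<Sum>h\<in>labellings V. a N g - a N h)) / fact (card V) = a N g"
      by (simp add: sum_subtractf S)
  qed
  ultimately show ?thesis
    unfolding a_def p_def by (auto intro: Lim_transform_eventually)
qed

end

section \<open>From labellings to orientations\<close>

theorem theorem5p6:
  fixes V :: "'a set" and E :: "'a set set" and n :: nat
    and M :: "'w measure" and e :: "nat \<Rightarrow> 'w \<Rightarrow> 'a set"
    and f0 :: "'a \<Rightarrow> nat" and D :: "('a \<times> 'a) set"
  assumes "simple_graph V E" and "connected_graph V E" and "card V = n"
    and "prob_space M" and "iid_uniform_edges M E e"
    and "bij_betw f0 V {1..n}"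
    and "acyclic_orientation E D"
  shows "(\<lambda>N. (1 / real N) *
            (\<Sum>t=1..N. measure M {\<omega> \<in> space M. edge_label_reversal E f0 e t \<omega> = D}))
         \<longlonglongrightarrow> real (card (linear_extensions V D)) / fact n"
proof -
  interpret prob_space M by fact
  note iid = \<open>iid_uniform_edges M E e\<close>
  define f where "f = restrict f0 V"
  define L where "L = linear_extensions V D"
  have "finite V" and edges: "\<And>x. x \<in> E \<Longrightarrow> card x = 2 \<and> x \<subseteq> V"
    using \<open>simple_graph V E\<close> by (auto simp: simple_graph_def)
  then have "finite E"
    by (auto intro: finite_subset[of E "Pow V"])
  have "bij_betw f V {1..card V}"
    using \<open>bij_betw f0 V {1..n}\<close> unfolding \<open>card V = n\<close> f_def
    by (rule bij_betw_cong[THEN iffD1, rotated]) simp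
  then have f: "f \<in> labellings V"
    by (simp add: labellings_def f_def)
  have L: "L = {h \<in> labellings V. induced_orientation E h = D}"
    using \<open>acyclic_orientation E D\<close> linear_extensions_eq[OF \<open>simple_graph V E\<close>]
    by (auto simp: L_def acyclic_orientation_def)
  then have "finite L"
    using card_labellings[OF f \<open>finite V\<close>] by auto
  \<comment> \<open>The event is the disjoint union, over the linear extensions \<open>h\<close> of
    \<open>D\<close>, of the events that the restricted process is at \<open>h\<close>. Each of them
    contributes 1/n! to the limit.\<close>
  have prob_D: "prob {\<omega> \<in> space M. edge_label_reversal E f0 e t \<omega> = D}
      = (\<Sum>h\<in>L. prob {\<omega> \<in> space M. labelling f e t \<omega> = h})" for t
  proof -
    have "edge_label_reversal E f0 e t \<omega> = D \<longleftrightarrow> labelling f e t \<omega> \<in> L" if "\<omega> \<in> space M" for \<omega>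
    proof -
      have e: "card (e t \<omega>) = 2 \<and> e t \<omega> \<subseteq> V" if "t \<ge> 1" for t
        using measurable_space[OF edge_measurable[OF iid that] \<open>\<omega> \<in> space M\<close>] edges by auto
      have "edge_label_reversal E f0 e t \<omega> = induced_orientation E (labelling f e t \<omega>)"
        unfolding edge_label_reversal_def f_def
        by (subst labelling_restrict[where e = e and \<omega> = \<omega>, OF e])
          (simp_all add: induced_orientation_restrict[OF \<open>simple_graph V E\<close>])
      moreover have "labelling f e t \<omega> \<in> labellings V"
        using labelling_in_labellings[where e = e and \<omega> = \<omega>, OF f e] .
      ultimately show ?thesis
        by (simp add: L)
    qed
    then have "{\<omega> \<in> space M. edge_label_reversal E f0 e t \<omega> = D}
        = (\<Union>h\<in>L. {\<omega> \<in> space M. labelling f e t \<omega> = h})"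
      by auto
    also have "prob \<dots> = (\<Sum>h\<in>L. prob {\<omega> \<in> space M. labelling f e t \<omega> = h})"
      using \<open>finite L\<close> labelling_measurable[OF iid \<open>finite E\<close>]
      by (intro finite_measure_finite_Union) (auto simp: disjoint_family_on_def)
    finally show ?thesis .
  qed
  have "(\<lambda>N. \<Sum>h\<in>L. (\<Sum>t=1..N. prob {\<omega> \<in> space M. labelling f e t \<omega> = h}) / N)
      \<longlonglongrightarrow> (\<Sum>h\<in>L. 1 / fact (card V))"
    by (intro tendsto_sum cesaro_labelling_tendsto_uniform[OF assms(1,2) iid f]) (simp add: L)
  moreover have "(\<Sum>h\<in>L. (\<Sum>t=1..N. prob {\<omega> \<in> space M. labelling f e t \<omega> = h}) / N)
      = (1 / real N) * (\<Sum>t=1..N. prob {\<omega> \<in> space M. edge_label_reversal E f0 e t \<omega> = D})" for N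
    unfolding prob_D sum_divide_distrib[symmetric] by (subst sum.swap) simp
  ultimately show ?thesis
    using \<open>card V = n\<close> by (simp add: L_def)
qed

end
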